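(* Let $\mathcal{D}$ be a Ryser design of Type-2 of order $v$ and index $\lambda$. Let $A$ be a non average block of $\mathcal{D}$, and let $\overline{\mathcal{D}}=\mathcal{D}*A$ be the new Ryser design of order $v$ and index $\overline{\lambda}=|A|-\lambda$ obtained from $\mathcal{D}$ by block complementation with respect to $A$. If $A$ is a large (respectively small) block in $\mathcal{D}$, then $A$ is a small (respectively large) block in $\overline{\mathcal{D}}$. Let $B$ be any other block of $\mathcal{D}$ and let $\overline{B}=A\triangle B$ be the new block of $\overline{\mathcal{D}}$ obtained from $B$. Then: (i) If $|B|>|A|$ (respectively $|B|<|A|$), then $\overline{B}$ is a large (respectively small) block in $\overline{\mathcal{D}}$. (ii) If $|B|=2\lambda$, then $|\overline{B}|=|A|$. (iii) If $|B|=|A|$, then $|\overline{B}|=2\overline{\lambda}$.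
   Context: A design is a pair $(X,L)$ with $X$ a finite set (points) and $L$ a set of subsets of $X$ (blocks). A symmetric $(v,k,\lambda)$ design is a design $(X,L)$ with $|X|=|L|=v$, $|B_1\cap B_2|=\lambda\geq 1$ for all distinct blocks $B_1,B_2$, and $|B|=k>\lambda$ for every block $B$. A Ryser design of order $v$ and index $\lambda$ is a design $(X,L)$ with $|X|=|L|=v$, $|B_1\cap B_2|=\lambda$ for all distinct blocks $B_1,B_2$, $|B|>\lambda$ for every block $B$, and such that there exist blocks $B_1,B_2$ with $|B_1|\neq|B_2|$. In a Ryser design of index $\lambda$, a block $A$ is large, average or small if $|A|>2\lambda$, $|A|=2\lambda$ or $|A|<2\lambda$ respectively; a block that is not average is called non average. In $\overline{\mathcal{D}}$ these notions refer to its own index $\overline{\lambda}$. For a design $\mathcal{D}=(X,\mathcal{A})$ and a block $A\in\mathcal{A}$, the block complementation of $\mathcal{D}$ with respect to $A$ is $\mathcal{D}*A=(X,\mathcal{B})$ with $\mathcal{B}=\{A\}\cup\{A\triangle B: B\in\mathcal{A}, B\neq A\}$, where $\triangle$ is symmetric difference. If $\mathcal{D}$ is a symmetric $(v,k,k-\lambda)$ design with $k\neq 2\lambda$ and $A$ is a block of $\mathcal{D}$, then $\mathcal{D}*A$ is a Ryser design of order $v$ and index $\lambda$; a Ryser design obtained in this way from some symmetric design is said to be of Type-1. A Ryser design is of Type-2 if it is not of Type-1. *)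

theory Defs
  imports Main
begin

type_synonym 'a design = "'a set \<times> 'a set set"

abbreviation points :: "'a design \<Rightarrow> 'a set" where
  "points D \<equiv> fst D"

abbreviation blocks :: "'a design \<Rightarrow> 'a set set" where
  "blocks D \<equiv> snd D"

definition is_design :: "'a design \<Rightarrow> bool" where
  "is_design D \<longleftrightarrow> finite (points D) \<and> blocks D \<subseteq> Pow (points D)"

definition symmetric_design :: "'a design \<Rightarrow> nat \<Rightarrow> nat \<Rightarrow> nat \<Rightarrow> bool" where
  "symmetric_design D v k lam \<longleftrightarrow>
     is_design D \<and> card (points D) = v \<and> card (blocks D) = v \<and>
     lam \<ge> 1 \<and>
     (\<forall>B\<^sub>1\<in>blocks D. \<forall>B\<^sub>2\<in>blocks D. B\<^sub>1 \<noteq> B\<^sub>2 \<longrightarrow> card (B\<^sub>1 \<inter> B\<^sub>2) = lam) \<and>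
     (\<forall>B\<in>blocks D. card B = k) \<and> k > lam"

definition ryser_design :: "'a design \<Rightarrow> nat \<Rightarrow> nat \<Rightarrow> bool" where
  "ryser_design D v lam \<longleftrightarrow>
     is_design D \<and> card (points D) = v \<and> card (blocks D) = v \<and>
     (\<forall>B\<^sub>1\<in>blocks D. \<forall>B\<^sub>2\<in>blocks D. B\<^sub>1 \<noteq> B\<^sub>2 \<longrightarrow> card (B\<^sub>1 \<inter> B\<^sub>2) = lam) \<and>
     (\<forall>B\<in>blocks D. card B > lam) \<and>
     (\<exists>B\<^sub>1\<in>blocks D. \<exists>B\<^sub>2\<in>blocks D. card B\<^sub>1 \<noteq> card B\<^sub>2)"

definition block_complementation :: "'a design \<Rightarrow> 'a set \<Rightarrow> 'a design" where
  "block_complementation D A =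
     (points D, {A} \<union> {sym_diff A B | B. B \<in> blocks D \<and> B \<noteq> A})"

text \<open>The subtraction \<open>k - lam\<close> below is on natural numbers, but it never truncates:
  \<^const>\<open>symmetric_design\<close> requires its last parameter to be at least 1.\<close>

definition ryser_type1 :: "'a design \<Rightarrow> nat \<Rightarrow> nat \<Rightarrow> bool" where
  "ryser_type1 D v lam \<longleftrightarrow>
     ryser_design D v lam \<and>
     (\<exists>E k A. symmetric_design E v k (k - lam) \<and> k \<noteq> 2 * lam \<and>
        A \<in> blocks E \<and> D = block_complementation E A)"

definition ryser_type2 :: "'a design \<Rightarrow> nat \<Rightarrow> nat \<Rightarrow> bool" where
  "ryser_type2 D v lam \<longleftrightarrow> ryser_design D v lam \<and> \<not> ryser_type1 D v lam"

definition large_block :: "'a design \<Rightarrow> nat \<Rightarrow> 'a set \<Rightarrow> bool" where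
  "large_block D lam A \<longleftrightarrow> A \<in> blocks D \<and> card A > 2 * lam"

definition average_block :: "'a design \<Rightarrow> nat \<Rightarrow> 'a set \<Rightarrow> bool" where
  "average_block D lam A \<longleftrightarrow> A \<in> blocks D \<and> card A = 2 * lam"

definition small_block :: "'a design \<Rightarrow> nat \<Rightarrow> 'a set \<Rightarrow> bool" where
  "small_block D lam A \<longleftrightarrow> A \<in> blocks D \<and> card A < 2 * lam"

end

theory Submission
  imports Defs
begin

text \<open>If \<open>|A \<inter> B| = \<lambda>\<close> then \<open>|A \<triangle> B| = |A| + |B| - 2\<lambda>\<close>, so with
  \<open>\<lambda>' = |A| - \<lambda>\<close> one gets \<open>|A \<triangle> B| - 2\<lambda>' = |B| - |A|\<close>; all size claims are instances of this.
  The Type-2 hypothesis is what makes \<open>D * A\<close> have two block sizes: otherwise \<open>D * A\<close> would be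
  a symmetric design, and since complementation with respect to \<open>A\<close> is an involution,
  \<open>D = (D * A) * A\<close> would be of Type-1. The index \<open>\<lambda> = 0\<close>, which the definition of a Ryser design
  does not rule out, is impossible because \<open>v\<close> disjoint nonempty blocks on \<open>v\<close> points are singletons.\<close>

text \<open>Each of \<open>card A\<close> and \<open>card B\<close> counts the common points once,
  and the symmetric difference omits them. The additive form avoids truncated subtraction.\<close>

lemma card_sym_diff:
  assumes "finite A" "finite B"
  shows "card (sym_diff A B) + 2 * card (A \<inter> B) = card A + card B"
proof -
  have "card (sym_diff A B) = card (A - B) + card (B - A)"
    using assms by (intro card_Un_disjoint) auto
  moreover have "card A = card (A \<inter> B) + card (A - B)"
    using assms card_Int_Diff by blast
  moreover have "card B = card (A \<inter> B) + card (B - A)"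
    using assms card_Int_Diff[of B A] by (simp add: Int_commute)
  ultimately show ?thesis by simp
qed

text \<open>The common points are those in \<open>A\<close> alone and those in \<open>B\<close> and
  \<open>C\<close> but not \<open>A\<close>. With t the size of the triple intersection, these parts
  have |A| - 2 lam + t and lam - t points, so the unknown t cancels.\<close>

lemma card_sym_diff_Int_sym_diff:
  assumes fin: "finite A" "finite B" "finite C"
    and lam: "card (A \<inter> B) = lam" "card (A \<inter> C) = lam" "card (B \<inter> C) = lam"
  shows "card (sym_diff A B \<inter> sym_diff A C) = card A - lam"
proof -
  define T where "T = A \<inter> B \<inter> C"
  have eq: "sym_diff A B \<inter> sym_diff A C = (A - (B \<union> C)) \<union> (B \<inter> C - A)"
    by auto
  have "card ((A - (B \<union> C)) \<union> (B \<inter> C - A)) = card (A - (B \<union> C)) + card (B \<inter> C - A)"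
    using fin by (intro card_Un_disjoint) auto
  moreover have "card (B \<inter> C) = card T + card (B \<inter> C - A)"
    using card_Int_Diff[of "B \<inter> C" A] fin by (simp add: T_def Int_ac)
  moreover have "card A = card (A \<inter> (B \<union> C)) + card (A - (B \<union> C))"
    using card_Int_Diff fin by blast
  moreover have "card (A \<inter> B) + card (A \<inter> C) = card (A \<inter> (B \<union> C)) + card T"
  proof -
    have "(A \<inter> B) \<union> (A \<inter> C) = A \<inter> (B \<union> C)" "(A \<inter> B) \<inter> (A \<inter> C) = T"
      by (auto simp: T_def)
    then show ?thesis
      using card_Un_Int[of "A \<inter> B" "A \<inter> C"] fin by simp
  qed
  ultimately show ?thesis
    using lam eq by simp
qed

lemma sym_diff_sym_diff: "sym_diff A (sym_diff A B) = B"
  by auto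

lemma sym_diff_eq_left_iff: "A = sym_diff A B \<longleftrightarrow> B = {}"
  by auto

text \<open>Since \<open>sym_diff A\<close> undoes itself, the only danger is that some
  \<open>sym_diff A B\<close> equals \<open>A\<close> and is skipped in the second round. This would
  force \<open>B\<close> to be empty.\<close>

lemma block_complementation_involution:
  assumes "A \<in> blocks D" "{} \<notin> blocks D"
  shows "block_complementation (block_complementation D A) A = D"
proof -
  have ne: "sym_diff A B \<noteq> A" if "B \<in> blocks D" for B
    using that assms(2) sym_diff_eq_left_iff[of A B] by metis
  have "blocks (block_complementation (block_complementation D A) A)
      = insert A {sym_diff A (sym_diff A B) | B. B \<in> blocks D \<and> B \<noteq> A}"
    unfolding block_complementation_def using ne by auto
  also have "\<dots> = blocks D"
    unfolding sym_diff_sym_diff using assms(1) by auto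
  finally show ?thesis
    by (intro prod_eqI) (simp_all add: block_complementation_def)
qed

text \<open>A self-inverse map is injective, and without an empty block it never hits
  \<open>A\<close>, so no two new blocks coincide.\<close>

lemma card_blocks_block_complementation:
  assumes "A \<in> blocks D" "{} \<notin> blocks D" "finite (blocks D)"
  shows "card (blocks (block_complementation D A)) = card (blocks D)"
proof -
  have eq: "blocks (block_complementation D A) = insert A (sym_diff A ` (blocks D - {A}))"
    unfolding block_complementation_def by auto
  have inj: "inj_on (sym_diff A) (blocks D - {A})"
    by (rule inj_on_inverseI[where g = "sym_diff A"]) (rule sym_diff_sym_diff)
  have "A \<notin> sym_diff A ` (blocks D - {A})"
    using assms(2) by (auto simp: sym_diff_eq_left_iff)
  then have "card (blocks (block_complementation D A)) = Suc (card (blocks D - {A}))"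
    unfolding eq using assms(3) inj by (simp add: card_image)
  then show ?thesis
    using assms(1,3) by (metis card_Suc_Diff1)
qed

lemma ryser_design_index_pos:
  assumes "ryser_design D v lam"
  shows "lam > 0"
proof (rule ccontr)
  assume "\<not> lam > 0"
  then have lam0: "lam = 0" by simp
  note r = assms[unfolded ryser_design_def is_design_def lam0]
  have finX: "finite (points D)" and sub: "blocks D \<subseteq> Pow (points D)"
    using r by blast+
  have finL: "finite (blocks D)"
    using finX sub by (meson finite_Pow_iff finite_subset)
  have finB: "finite B" if "B \<in> blocks D" for B
    using that sub finX by (meson PowD finite_subset subsetD)
  have disj: "pairwise disjnt (blocks D)"
  proof (intro pairwiseI)
    fix B C assume "B \<in> blocks D" "C \<in> blocks D" "B \<noteq> C"
    then have "card (B \<inter> C) = 0" "finite (B \<inter> C)" using r finB by auto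
    then show "disjnt B C" by (simp add: disjnt_def)
  qed
  \<comment> \<open>Two different block sizes occur, so some size is not 1. This makes the count
    strict: v < sum of block sizes \<le> v.\<close>
  have "(\<Sum>B\<in>blocks D. 1) < sum card (blocks D)"
  proof (rule sum_strict_mono_ex1)
    show "\<forall>B\<in>blocks D. 1 \<le> card B" using r by force
    obtain B where "B \<in> blocks D" "card B \<noteq> 1" using r by metis
    moreover have "0 < card B" using r \<open>B \<in> blocks D\<close> by blast
    ultimately show "\<exists>B\<in>blocks D. 1 < card B" by force
  qed (rule finL)
  also have "\<dots> = card (\<Union>(blocks D))"
    using card_Union_disjoint[OF disj finB] by simp
  also have "\<dots> \<le> card (points D)"
    using finX sub by (intro card_mono) auto
  finally show False using r by simp
qed

theorem theorem3p1:
  fixes D D' :: "'a design" and A :: "'a set" and v lam lam' :: nat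
  assumes "ryser_type2 D v lam"
    and "A \<in> blocks D" and "\<not> average_block D lam A"
    and "D' = block_complementation D A" and "lam' = card A - lam"
  shows "ryser_design D' v lam' \<and>
    (large_block D lam A \<longrightarrow> small_block D' lam' A) \<and>
    (small_block D lam A \<longrightarrow> large_block D' lam' A) \<and>
    (\<forall>B\<in>blocks D. B \<noteq> A \<longrightarrow>
       sym_diff A B \<in> blocks D' \<and>
       (card B > card A \<longrightarrow> large_block D' lam' (sym_diff A B)) \<and>
       (card B < card A \<longrightarrow> small_block D' lam' (sym_diff A B)) \<and>
       (card B = 2 * lam \<longrightarrow> card (sym_diff A B) = card A) \<and>
       (card B = card A \<longrightarrow> card (sym_diff A B) = 2 * lam'))"
proof -
  note r2 = assms(1)[unfolded ryser_type2_def]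
  have ryser: "ryser_design D v lam" using r2 by blast
  note r = ryser[unfolded ryser_design_def is_design_def]
  have lam: "lam > 0" using ryser by (rule ryser_design_index_pos)
  have finX: "finite (points D)" and sub: "blocks D \<subseteq> Pow (points D)"
    and int: "\<And>B C. B \<in> blocks D \<Longrightarrow> C \<in> blocks D \<Longrightarrow> B \<noteq> C \<Longrightarrow> card (B \<inter> C) = lam"
    and gt: "\<And>B. B \<in> blocks D \<Longrightarrow> lam < card B"
    using r by blast+
  have finL: "finite (blocks D)"
    using finX sub by (meson finite_Pow_iff finite_subset)
  have finB: "finite B" if "B \<in> blocks D" for B
    using that sub finX by (meson PowD finite_subset subsetD)
  have empty: "{} \<notin> blocks D" using gt by fastforce
  have bD': "blocks D' = insert A {sym_diff A B | B. B \<in> blocks D \<and> B \<noteq> A}"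
    and pD': "points D' = points D"
    by (simp_all add: assms(4) block_complementation_def)
  have gtA: "lam < card A" using gt assms(2) .
  have na: "card A \<noteq> 2 * lam" using assms(2,3) by (simp add: average_block_def)
  have size: "card (sym_diff A B) + 2 * lam = card A + card B"
    if "B \<in> blocks D" "B \<noteq> A" for B
    using card_sym_diff[OF finB finB, OF assms(2) that(1)] int[OF assms(2) that(1)] that(2) by simp
  have mem: "sym_diff A B \<in> blocks D'" if "B \<in> blocks D" "B \<noteq> A" for B
    using that bD' by blast
  have intA: "card (A \<inter> sym_diff A B) = lam'" if "B \<in> blocks D" "B \<noteq> A" for B
  proof -
    have "A \<inter> sym_diff A B = A - B" by auto
    then show ?thesis
      using that finB assms(2,5) int[OF assms(2), of B] by (simp add: card_Diff_subset_Int)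
  qed
  have int': "card (B\<^sub>1 \<inter> B\<^sub>2) = lam'"
    if B: "B\<^sub>1 \<in> blocks D'" "B\<^sub>2 \<in> blocks D'" "B\<^sub>1 \<noteq> B\<^sub>2" for B\<^sub>1 B\<^sub>2
  proof -
    consider (1) "B\<^sub>1 = A" | (2) "B\<^sub>2 = A"
      | (3) B C where "B \<in> blocks D" "B \<noteq> A" "B\<^sub>1 = sym_diff A B"
          "C \<in> blocks D" "C \<noteq> A" "B\<^sub>2 = sym_diff A C"
      using B(1,2) unfolding bD' by blast
    then show ?thesis
    proof cases
      case 1
      then show ?thesis using B intA unfolding bD' by blast
    next
      case 2
      then obtain B where "B \<in> blocks D" "B \<noteq> A" "B\<^sub>1 = sym_diff A B"
        using B unfolding bD' by blast
      then show ?thesis using 2 intA by (simp add: Int_commute)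
    next
      case 3
      then have "B \<noteq> C" using B(3) by blast
      then show ?thesis
        unfolding 3(3,6) assms(5) using 3 assms(2) finB int
        by (intro card_sym_diff_Int_sym_diff) auto
    qed
  qed
  \<comment> \<open>For \<open>A\<close> itself this is \<open>lam > 0\<close>. For any other new
    block the excess over \<open>lam'\<close> is \<open>card C - lam\<close>, as \<open>size\<close>
    shows.\<close>
  have gt': "lam' < card B" if B: "B \<in> blocks D'" for B
  proof (cases "B = A")
    case True
    then show ?thesis using lam gtA assms(5) by simp
  next
    case False
    then obtain C where C: "C \<in> blocks D" "C \<noteq> A" "B = sym_diff A C"
      using B unfolding bD' by blast
    then show ?thesis using size[OF C(1,2)] gt[OF C(1)] gtA assms(5) by simp
  qed
  have des: "is_design D'"
    unfolding is_design_def pD' bD' using finX sub assms(2) by auto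
  have card_p: "card (points D') = v" using pD' r by simp
  have card_b: "card (blocks D') = v"
    using card_blocks_block_complementation[OF assms(2) empty finL] r assms(4) by simp
  have nonuniform: "\<exists>B\<^sub>1\<in>blocks D'. \<exists>B\<^sub>2\<in>blocks D'. card B\<^sub>1 \<noteq> card B\<^sub>2"
  proof (rule ccontr)
    assume "\<not> ?thesis"
    moreover have A': "A \<in> blocks D'" unfolding bD' by blast
    ultimately have "\<forall>B\<in>blocks D'. card B = card A" by blast
    \<comment> \<open>Here k is \<open>card A\<close>, so the intersection size \<open>lam'\<close>
      has the shape \<open>k - lam\<close> required by Type-1 with the original index. The condition
      \<open>k \<noteq> 2 * lam\<close> then says exactly that \<open>A\<close> is non
      average.\<close>
    then have "symmetric_design D' v (card A) (card A - lam)"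
      unfolding symmetric_design_def
      using des card_p card_b int' gtA lam assms(5) by auto
    moreover have "D = block_complementation D' A"
      using block_complementation_involution[OF assms(2) empty] assms(4) by simp
    ultimately have "ryser_type1 D v lam"
      unfolding ryser_type1_def using ryser na A' by blast
    then show False using r2 by blast
  qed
  have "ryser_design D' v lam'"
    unfolding ryser_design_def
    using des card_p card_b int' gt' nonuniform by blast
  moreover have "A \<in> blocks D'" unfolding bD' by blast
  moreover have "sym_diff A B \<in> blocks D' \<and>
      (card B > card A \<longrightarrow> large_block D' lam' (sym_diff A B)) \<and>
      (card B < card A \<longrightarrow> small_block D' lam' (sym_diff A B)) \<and>
      (card B = 2 * lam \<longrightarrow> card (sym_diff A B) = card A) \<and>
      (card B = card A \<longrightarrow> card (sym_diff A B) = 2 * lam')"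
    if "B \<in> blocks D" "B \<noteq> A" for B
    unfolding large_block_def small_block_def
    using mem[OF that] size[OF that] gtA assms(5) by linarith
  \<comment> \<open>By \<open>gtA\<close> the subtraction in \<open>lam'\<close> is exact, so 2 lam'
    - |A| = |A| - 2 lam: the block \<open>A\<close> swaps sides of the average.\<close>
  moreover have "large_block D lam A \<longrightarrow> 2 * lam' > card A"
    "small_block D lam A \<longrightarrow> 2 * lam' < card A"
    unfolding large_block_def small_block_def using gtA assms(5) by linarith+
  ultimately show ?thesis
    unfolding large_block_def[of D'] small_block_def[of D'] by blast
qed

end
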